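(* Let $0<\alpha\le1$ and $\lambda=\mu>0$. The Adomian series components $\tilde p_k^\alpha(n,t)$, $n,k\ge0$, $t\ge0$, of the state probabilities of the linear fractional birth-death process are given by $$\tilde p_k^\alpha(n,t)=\begin{cases}0,& n=k=0\ \text{or}\ n-k\ge2,\\[1mm] -\dfrac{k!}{\Gamma(k\alpha+1)}(-\lambda t^\alpha)^k,& n=0,\ k\ge1,\\[2mm] (-1)^{n+1}\dbinom{k+1}{n}\dfrac{k!}{\Gamma(k\alpha+1)}(-\lambda t^\alpha)^k,& n\ge1,\ n-k<2.\end{cases}$$
   Context: The linear fractional birth-death process has birth rates $\lambda_n=n\lambda$ and death rates $\mu_n=n\mu$, $n\ge0$, and starts from one individual. With $I_t^\alpha g(t)=\frac{1}{\Gamma(\alpha)}\int_0^t (t-s)^{\alpha-1}g(s)\,\mathrm{d}s$ (Riemann–Liouville fractional integral), the Adomian series components of its state probabilities are defined recursively by $\tilde p_0^\alpha(1,t)=1$, $\tilde p_0^\alpha(n,t)=0$ for $n\ne1$, and for $k\ge1$, $n\ge0$, $$\tilde p_k^\alpha(n,t)=I_t^\alpha\big(-n(\lambda+\mu)\tilde p_{k-1}^\alpha(n,t)+(n-1)\lambda\,\tilde p_{k-1}^\alpha(n-1,t)+(n+1)\mu\,\tilde p_{k-1}^\alpha(n+1,t)\big),$$ with $\tilde p_k^\alpha(-1,t)=0$. *)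

theory Defs
  imports "HOL-Analysis.Analysis"
begin

definition RL_integral :: "real \<Rightarrow> (real \<Rightarrow> real) \<Rightarrow> real \<Rightarrow> real" where
  "RL_integral \<alpha> g t =
     1 / Gamma \<alpha> * integral {0..t} (\<lambda>s. (t - s) powr (\<alpha> - 1) * g s)"

text \<open>The component for the nonexistent state \<open>-1\<close> is zero; hence the case distinction on
  \<open>n = 0\<close>, as \<open>n - 1\<close> is truncated on the natural numbers.\<close>

primrec adomian_component ::
  "real \<Rightarrow> real \<Rightarrow> real \<Rightarrow> nat \<Rightarrow> nat \<Rightarrow> real \<Rightarrow> real" where
  "adomian_component \<alpha> lam mu 0 n = (\<lambda>t. if n = 1 then 1 else 0)"
| "adomian_component \<alpha> lam mu (Suc k) n =
     RL_integral \<alpha> (\<lambda>s.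
         - real n * (lam + mu) * adomian_component \<alpha> lam mu k n s
         + (if n = 0 then 0
            else (real n - 1) * lam * adomian_component \<alpha> lam mu k (n - 1) s)
         + (real n + 1) * mu * adomian_component \<alpha> lam mu k (n + 1) s)"

end

theory Submission imports Defs begin

text \<open>
  In the critical case \<open>lam = mu\<close> every component is a single monomial in \<open>t powr \<alpha>\<close>: the
  Riemann--Liouville integral maps \<open>s powr \<beta>\<close> to
  \<open>Gamma (\<beta> + 1) / Gamma (\<beta> + \<alpha> + 1) * t powr (\<beta> + \<alpha>)\<close> (a rescaled Beta integral), so with
  \<open>\<beta> = k * \<alpha>\<close> the factors \<open>1 / Gamma (k * \<alpha> + 1)\<close> telescope and only the constant coefficients
  are left to determine. Up to powers of \<open>lam\<close> these obey the recursion of the birth-death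
  generator, a second-order difference recursion in the state \<open>n\<close>. The candidate
  \<open>(-1)^(n+1+k) * fact k * ((k+1) choose n)\<close> solves it because of an identity between three
  neighbouring binomial coefficients, which is obtained from the absorption identity and Pascal's
  rule.

  The candidate already contains the vanishing beyond \<open>n = k + 1\<close>. Its only false value is the
  one at \<open>n = k = 0\<close>. Correcting it to zero does no harm to the recursion, because state 0
  is absorbing: the weight with which it feeds any other state, or itself, is zero.
\<close>

text \<open>The substitution \<open>s = t * x\<close> turns the convolution integral into Euler's Beta integral.\<close>

lemma has_integral_Beta_scaled:
  fixes a b t :: real
  assumes "a > 0" "b > 0" "t > 0"
  shows "((\<lambda>s. (t - s) powr (b - 1) * s powr (a - 1)) has_integral
           t powr (a + b - 1) * Beta a b) {0..t}"
proof -
  let ?f = "\<lambda>x::real. x powr (a - 1) * (1 - x) powr (b - 1)"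
  have "((\<lambda>s. ?f ((1 / t) * s)) has_integral (1 / \<bar>1 / t\<bar>) *\<^sub>R Beta a b)
          ((\<lambda>x. x / (1 / t)) ` {0..1})"
    by (rule has_integral_stretch_real[OF has_integral_Beta_real]) (use assms in simp_all)
  also have "(\<lambda>x. x / (1 / t)) ` {0..1} = {0..t}"
    using assms image_mult_atLeastAtMost[of t 0 1] by (simp add: mult.commute)
  finally have scaled: "((\<lambda>s. t powr (a + b - 2) * ?f (s / t)) has_integral
                  t powr (a + b - 2) * (t * Beta a b)) {0..t}"
    using assms by (intro has_integral_mult_right) simp
  have total: "t powr (a + b - 2) * (t * Beta a b) = t powr (a + b - 1) * Beta a b"
    using assms powr_mult_base[of t "a + b - 2"] by (simp add: mult_ac)
  have integrand: "t powr (a + b - 2) * ?f (s / t) = (t - s) powr (b - 1) * s powr (a - 1)"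
    if "s \<in> {0..t}" for s
  proof -
    have "1 - s / t = (t - s) / t"
      using assms by (simp add: field_simps)
    moreover have "t powr (a + b - 2) = t powr (a - 1) * t powr (b - 1)"
      by (simp flip: powr_add)
    ultimately show ?thesis
      using assms that by (simp add: powr_divide)
  qed
  show ?thesis
    by (rule has_integral_eq[OF integrand scaled[unfolded total]])
qed

lemma RL_integral_cong:
  assumes "\<And>s. 0 \<le> s \<Longrightarrow> s \<le> t \<Longrightarrow> f s = g s"
  shows "RL_integral \<alpha> f t = RL_integral \<alpha> g t"
  unfolding RL_integral_def using assms
  by (intro arg_cong2[where f = "(*)"] Henstock_Kurzweil_Integration.integral_cong) auto

lemma RL_integral_cmult: "RL_integral \<alpha> (\<lambda>s. c * g s) t = c * RL_integral \<alpha> g t"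
proof -
  have "(\<lambda>s. (t - s) powr (\<alpha> - 1) * (c * g s)) = (\<lambda>s. c * ((t - s) powr (\<alpha> - 1) * g s))"
    by (simp add: mult_ac)
  then show ?thesis
    by (simp add: RL_integral_def)
qed

text \<open>
  The monomials are natural powers of \<open>s powr \<alpha>\<close> rather than \<open>s powr (real k * \<alpha>)\<close>: for
  \<open>k = 0\<close> the former is the constant 1 also at \<open>s = 0\<close>, whereas \<open>0 powr 0 = 0\<close>. The two differ at
  most at this point, which the integral does not see.
\<close>

lemma RL_integral_powr_power:
  assumes "\<alpha> > 0" "t \<ge> 0"
  shows "RL_integral \<alpha> (\<lambda>s. (s powr \<alpha>) ^ k) t =
           Gamma (real k * \<alpha> + 1) / Gamma (real (Suc k) * \<alpha> + 1) * (t powr \<alpha>) ^ Suc k"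
proof (cases "t = 0")
  case True
  then show ?thesis
    by (simp add: RL_integral_def)
next
  case False
  with assms have t: "t > 0" by simp
  have power: "(s powr \<alpha>) ^ j = s powr (real j * \<alpha>)" if "s > 0" for s j
    using that by (simp add: powr_power)
  have "((\<lambda>s. (t - s) powr (\<alpha> - 1) * s powr (real k * \<alpha> + 1 - 1)) has_integral
          t powr (real k * \<alpha> + 1 + \<alpha> - 1) * Beta (real k * \<alpha> + 1) \<alpha>) {0..t}"
    using assms t by (intro has_integral_Beta_scaled) (auto intro: add_nonneg_pos)
  then have "((\<lambda>s. (t - s) powr (\<alpha> - 1) * (s powr \<alpha>) ^ k) has_integral
          t powr (real k * \<alpha> + 1 + \<alpha> - 1) * Beta (real k * \<alpha> + 1) \<alpha>) {0..t}"
    by (rule has_integral_spike_finite[where S = "{0}", rotated 2]) (auto simp: power)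
  moreover have "real k * \<alpha> + 1 + \<alpha> - 1 = real (Suc k) * \<alpha>"
    by (simp add: algebra_simps)
  ultimately have "integral {0..t} (\<lambda>s. (t - s) powr (\<alpha> - 1) * (s powr \<alpha>) ^ k) =
          (t powr \<alpha>) ^ Suc k * Beta (real k * \<alpha> + 1) \<alpha>"
    using power[OF t, of "Suc k"] by (simp add: integral_unique)
  moreover have "Gamma \<alpha> \<noteq> 0"
    using Gamma_real_pos[OF assms(1)] by linarith
  moreover have "real k * \<alpha> + 1 + \<alpha> = real (Suc k) * \<alpha> + 1"
    by (simp add: algebra_simps)
  ultimately show ?thesis
    by (simp add: RL_integral_def Beta_def del: of_nat_Suc power_Suc)
qed

definition critical_coeff :: "nat \<Rightarrow> nat \<Rightarrow> real" where
  "critical_coeff k n =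
     (if n = 0 \<and> k = 0 then 0 else (-1) ^ (n + 1 + k) * fact k * real ((k + 1) choose n))"

text \<open>
  Absorption gives \<open>(n+2) * C (n+2) = (m - (n+1)) * C (n+1)\<close> and \<open>(n+1) * C (n+1) = (m - n) * C n\<close>
  for \<open>C j = m choose j\<close>; the sum then collapses to \<open>m * (C n + C (n+1))\<close>.
\<close>

lemma binomial_three_term:
  fixes m n :: nat
  shows "2 * (real n + 1) * real (m choose Suc n) + real n * real (m choose n)
           + (real n + 2) * real (m choose Suc (Suc n))
         = real m * real (Suc m choose Suc n)"
proof -
  have absorb: "(real j + 1) * real (m choose Suc j) = (real m - real j) * real (m choose j)" for j
  proof (cases "j \<le> m")
    case True
    have "Suc j * (m choose Suc j) = (m - j) * (m choose j)"
      by (metis binomial_absorb_comp binomial_absorption)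
    then have "real (Suc j * (m choose Suc j)) = real ((m - j) * (m choose j))"
      by (rule arg_cong)
    then show ?thesis
      using True by (simp add: of_nat_diff algebra_simps)
  qed (simp add: binomial_eq_0)
  show ?thesis
    using absorb[of n] absorb[of "Suc n"] by (simp add: algebra_simps)
qed

lemma critical_coeff_Suc:
  "critical_coeff (Suc k) n =
     - 2 * real n * critical_coeff k n
     + (if n = 0 then 0 else (real n - 1) * critical_coeff k (n - 1))
     + (real n + 1) * critical_coeff k (n + 1)"
proof (cases n)
  case 0
  then show ?thesis
    by (simp add: critical_coeff_def algebra_simps)
next
  case (Suc m)
  \<comment> \<open>At \<open>m = 0\<close> the corrected value \<open>critical_coeff 0 0 = 0\<close> is absorbed by the factor \<open>m\<close>.\<close>
  have weighted: "real m * critical_coeff k m =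
      real m * ((-1) ^ (m + 1 + k) * fact k * real ((k + 1) choose m))"
    by (simp add: critical_coeff_def)
  have "critical_coeff (Suc k) n =
      (-1) ^ (m + 1 + k) * fact k * (real (Suc k) * real (Suc (Suc k) choose Suc m))"
    by (simp add: critical_coeff_def Suc algebra_simps del: binomial_Suc_Suc)
  also have "\<dots> = (-1) ^ (m + 1 + k) * fact k *
      (2 * (real m + 1) * real (Suc k choose Suc m) + real m * real (Suc k choose m)
           + (real m + 2) * real (Suc k choose Suc (Suc m)))"
    using binomial_three_term[of m "Suc k"] by simp
  also have "\<dots> = - 2 * real n * critical_coeff k n + real m * critical_coeff k m
                   + (real n + 1) * critical_coeff k (n + 1)"
    unfolding weighted by (simp add: critical_coeff_def Suc algebra_simps del: binomial_Suc_Suc)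
  finally show ?thesis
    using Suc by simp
qed

lemma adomian_component_critical:
  assumes "\<alpha> > 0" "t \<ge> 0"
  shows "adomian_component \<alpha> lam lam k n t =
           lam ^ k * critical_coeff k n / Gamma (real k * \<alpha> + 1) * (t powr \<alpha>) ^ k"
  using \<open>t \<ge> 0\<close>
proof (induction k arbitrary: n t)
  case 0
  \<comment> \<open>For \<open>k = 0\<close> the coefficient contains \<open>1 choose n\<close>, which vanishes for \<open>n \<ge> 2\<close>.\<close>
  show ?case
    by (cases "n \<le> 1") (auto simp: critical_coeff_def binomial_eq_0 le_Suc_eq)
next
  case (Suc k)
  define G where "G = Gamma (real k * \<alpha> + 1)"
  define c where "c = lam ^ Suc k * critical_coeff (Suc k) n / G"
  have "G > 0"
    unfolding G_def using assms by (intro Gamma_real_pos add_nonneg_pos) auto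
  have "adomian_component \<alpha> lam lam (Suc k) n t = RL_integral \<alpha> (\<lambda>s. c * (s powr \<alpha>) ^ k) t"
    unfolding adomian_component.simps
    by (intro RL_integral_cong)
       (simp add: Suc.IH[folded G_def] c_def critical_coeff_Suc[of k n]
                  algebra_simps add_divide_distrib diff_divide_distrib)
  also have "\<dots> = c * (G / Gamma (real (Suc k) * \<alpha> + 1) * (t powr \<alpha>) ^ Suc k)"
    using RL_integral_powr_power[of \<alpha> t k] assms Suc.prems by (simp only: RL_integral_cmult G_def)
  also have "\<dots> = lam ^ Suc k * critical_coeff (Suc k) n / Gamma (real (Suc k) * \<alpha> + 1)
                    * (t powr \<alpha>) ^ Suc k"
    using \<open>G > 0\<close> by (simp add: c_def)
  finally show ?case .
qed

theorem corollary4p3: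
  fixes \<alpha> lam mu t :: real and n k :: nat
  assumes "0 < \<alpha>" and "\<alpha> \<le> 1"
    and "lam = mu" and "mu > 0"
    and "t \<ge> 0"
  shows "((n = 0 \<and> k = 0) \<or> int n - int k \<ge> 2 \<longrightarrow>
            adomian_component \<alpha> lam mu k n t = 0)
       \<and> (n = 0 \<and> k \<ge> 1 \<longrightarrow>
            adomian_component \<alpha> lam mu k n t =
              - (fact k / Gamma (real k * \<alpha> + 1)) * (- lam * t powr \<alpha>) ^ k)
       \<and> (n \<ge> 1 \<and> int n - int k < 2 \<longrightarrow>
            adomian_component \<alpha> lam mu k n t =
              (- 1) ^ (n + 1) * real ((k + 1) choose n)
                * (fact k / Gamma (real k * \<alpha> + 1)) * (- lam * t powr \<alpha>) ^ k)"
proof -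
  have component: "adomian_component \<alpha> lam mu k n t =
      lam ^ k * critical_coeff k n / Gamma (real k * \<alpha> + 1) * (t powr \<alpha>) ^ k"
    using adomian_component_critical assms by simp
  have sign: "(- lam * t powr \<alpha>) ^ k = (-1) ^ k * lam ^ k * (t powr \<alpha>) ^ k"
    by (metis mult_minus1 power_mult_distrib)
  have "critical_coeff k n = 0" if "(n = 0 \<and> k = 0) \<or> int n - int k \<ge> 2"
    using that by (auto simp: critical_coeff_def binomial_eq_0)
  moreover have "critical_coeff k n = (-1) ^ (n + 1) * real ((k + 1) choose n) * fact k * (-1) ^ k"
    if "n \<ge> 1 \<or> k \<ge> 1"
    using that by (auto simp: critical_coeff_def power_add)
  ultimately show ?thesis
    unfolding component sign by auto
qed

end
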